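(* (1) Suppose condition $(gL_0)$ holds: $\lim_{\lambda\to\infty}\sup_{y\in\mathbb R}\big\|\frac{\delta_t(\lambda(0,y))}{\lambda}\big\|_\infty=0$ for $t=0,\dots,T$. Then $(NSA)$ is equivalent to $(\overline{NSA})$. (2) Suppose $\|\overline S_T(0)\|_\infty<\infty$ and condition $(L_0)$ holds: $\lim_{\lambda\to\infty}\sup_{|y|\le M}\big\|\frac{\delta_t(\lambda(0,y))}{\lambda}\big\|_\infty=0$ for every $M\in(0,\infty)$ and $t=0,\dots,T$. Then $(NrbSA)$ is equivalent to $(\overline{NrbSA})$.
   Context: Market with concave transaction costs. Let $(\Omega,\mathcal F,(\mathcal F_t)_{t=0,\dots,T},\mathbb P)$ be a filtered probability space in discrete time; all relations between random variables hold $\mathbb P$-a.e. There are fixed-cost constants $b_0\le 0\le a_0$. For each $t$ there are $\mathcal F_t$-measurable random price curves, a bid curve $m\mapsto\underline S_t(m)$, $m\ge0$, and an ask curve $l\mapsto\overline S_t(l)$, $l\ge0$. Selling $m$ assets yields $b_t(m)=b_0+m\underline S_t(m)$; buying $l$ assets costs $a_t(l)=a_0+l\overline S_t(l)$. Standing assumptions: (a1) $m\mapsto\underline S_t(m)$ is increasing and continuous with limit $\underline S_t(\infty)$ at $\infty$, differentiable for large $m$, and $\lim_{m\to\infty}m\underline S_t'(m)=0$; (a2) $m\mapsto b_t(m)$ is increasing and convex; (a3) $l\mapsto\overline S_t(l)$ is decreasing and continuous with limit $\overline S_t(\infty)$ at $\infty$, differentiable for large $l$, and $\lim_{l\to\infty}l\overline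 S_t'(l)=0$; (a4) $l\mapsto a_t(l)$ is increasing and concave; (a5) $\underline S_t(\infty)<\overline S_t(\infty)$. (Price curves constant in the volume are admitted.) $L_t(x,y)=x+(b_t(y))^+$ if $y\ge0$, $L_t(x,y)=x-a_t(-y)$ if $y<0$; $G_t=\{(x,y)\in\mathbb R^2: L_t(x,y)\ge0\}$. $\bar L_t(x,y)=x+y\,\underline S_t(\infty)$ if $y\ge0$, $\bar L_t(x,y)=x+y\,\overline S_t(\infty)$ if $y<0$; $\bar K_t=\{\bar L_t\ge0\}$ (the closure of the convex hull of $G_t$). $\delta_t(x,y)=\bar L_t(x,y)-L_t(x,y)$. $L^0(A_t,\mathcal F_t)$ is the set of $\mathcal F_t$-measurable random variables with values in $A_t$. $\|\cdot\|_\infty$ is the $L^\infty(\mathbb P)$ norm. Strong arbitrage $(SA)$ holds if there are $t\in\{0,\dots,T\}$, $B_t\in\mathcal F_t$ with $\mathbb P(B_t)>0$, $\xi_i\in L^0(-G_i,\mathcal F_i)$ ($i=0,\dots,T$) and an $\mathcal F_t$-measurable $m_t\geq 0$ such that $\xi_i=0$ for $i\le t-1$, $\xi_i=0$ on $B_t^c$ for $i\ge t$, and $V_T=\sum_{i=0}^T\xi_i$ satisfies $L_T(V_T)\ge m_t>0$ on $B_t$. Random bounded strong arbitrage $(rbSA)$ holds if the same is true and additionally there is $\alpha_t\in L^0((0,\infty),\mathcal F_t)$ with $|\xi_u|:=|\xi_u^1|+|\xi_u^2|\le\alpha_t$ on $B_t$ for all $u\ge t$, where $\xi_u=(\xi_u^1,\xi_u^2)$.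 $(\overline{SA})$ and $(\overline{rbSA})$ are the same notions with $G_i$ replaced by $\bar K_i$ (and $L_T$ by $\bar L_T$). $(NSA)$, $(NrbSA)$, $(\overline{NSA})$, $(\overline{NrbSA})$ denote the absence (negation) of $(SA)$, $(rbSA)$, $(\overline{SA})$, $(\overline{rbSA})$ respectively. *)

theory Defs
  imports "HOL-Probability.Probability"
begin

text \<open>The \<open>L\<^sup>\<infinity>\<close> norm, with value \<open>\<infinity>\<close> for functions that are not essentially bounded.\<close>

definition Linf_norm :: "'a measure \<Rightarrow> ('a \<Rightarrow> real) \<Rightarrow> ereal" where
  "Linf_norm M f = esssup M (\<lambda>\<omega>. ereal \<bar>f \<omega>\<bar>)"

text \<open>Random variables with values in a random set. As all relations between random variables,
  membership is only required almost everywhere with respect to \<open>M\<close>; measurability is with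
  respect to the sub-sigma-algebra \<open>F\<close>.\<close>

definition L0 :: "'a measure \<Rightarrow> 'a measure \<Rightarrow> ('a \<Rightarrow> 'b::topological_space set) \<Rightarrow> ('a \<Rightarrow> 'b) set" where
  "L0 M F A = {\<xi> \<in> borel_measurable F. AE \<omega> in M. \<xi> \<omega> \<in> A \<omega>}"

text \<open>The two arbitrage notions, for a generic family \<open>K\<close> of random solvency sets and a generic
  terminal liquidation value \<open>L\<close>. Only \<open>\<xi> 0, \<dots>, \<xi> T\<close> matter.\<close>

definition arbitrage_strategy ::
  "'a measure \<Rightarrow> (nat \<Rightarrow> 'a measure) \<Rightarrow> nat \<Rightarrow> (nat \<Rightarrow> 'a \<Rightarrow> (real \<times> real) set) \<Rightarrow> ('a \<Rightarrow> real \<times> real \<Rightarrow> real)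
    \<Rightarrow> nat \<Rightarrow> 'a set \<Rightarrow> (nat \<Rightarrow> 'a \<Rightarrow> real \<times> real) \<Rightarrow> ('a \<Rightarrow> real) \<Rightarrow> bool" where
  "arbitrage_strategy M F T K L t B \<xi> m \<longleftrightarrow>
     t \<le> T \<and> B \<in> sets (F t) \<and> measure M B > 0 \<and>
     (\<forall>i\<le>T. \<xi> i \<in> L0 M (F i) (\<lambda>\<omega>. uminus ` K i \<omega>)) \<and>
     m \<in> L0 M (F t) (\<lambda>_. {0..}) \<and>
     (\<forall>i<t. AE \<omega> in M. \<xi> i \<omega> = 0) \<and>
     (\<forall>i\<in>{t..T}. AE \<omega> in M. \<omega> \<notin> B \<longrightarrow> \<xi> i \<omega> = 0) \<and>
     (AE \<omega> in M. \<omega> \<in> B \<longrightarrow> L \<omega> (\<Sum>i=0..T. \<xi> i \<omega>) \<ge> m \<omega> \<and> m \<omega> > 0)"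

definition strong_arbitrage ::
  "'a measure \<Rightarrow> (nat \<Rightarrow> 'a measure) \<Rightarrow> nat \<Rightarrow> (nat \<Rightarrow> 'a \<Rightarrow> (real \<times> real) set) \<Rightarrow> ('a \<Rightarrow> real \<times> real \<Rightarrow> real) \<Rightarrow> bool" where
  "strong_arbitrage M F T K L \<longleftrightarrow> (\<exists>t B \<xi> m. arbitrage_strategy M F T K L t B \<xi> m)"

definition rb_strong_arbitrage ::
  "'a measure \<Rightarrow> (nat \<Rightarrow> 'a measure) \<Rightarrow> nat \<Rightarrow> (nat \<Rightarrow> 'a \<Rightarrow> (real \<times> real) set) \<Rightarrow> ('a \<Rightarrow> real \<times> real \<Rightarrow> real) \<Rightarrow> bool" where
  "rb_strong_arbitrage M F T K L \<longleftrightarrow>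
     (\<exists>t B \<xi> m. arbitrage_strategy M F T K L t B \<xi> m \<and>
        (\<exists>\<alpha>\<in>L0 M (F t) (\<lambda>_. {0<..}). \<forall>u\<in>{t..T}.
           AE \<omega> in M. \<omega> \<in> B \<longrightarrow> \<bar>fst (\<xi> u \<omega>)\<bar> + \<bar>snd (\<xi> u \<omega>)\<bar> \<le> \<alpha> \<omega>))"

text \<open>The filtration and the price curves are indexed by all of \<open>nat\<close>, but constrained only up to
  the horizon \<open>T\<close>, and only for nonnegative volumes. The limits \<open>Sb_inf\<close> and \<open>Sa_inf\<close> are carried as
  \<open>F t\<close>-measurable random variables because the convergence only holds almost everywhere.\<close>

locale concave_cost_market = prob_space M for M :: "'a measure" +
  fixes F :: "nat \<Rightarrow> 'a measure"
    and T :: nat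
    and b0 a0 :: real
    and Sb Sa :: "nat \<Rightarrow> 'a \<Rightarrow> real \<Rightarrow> real"
    and Sb_inf Sa_inf :: "nat \<Rightarrow> 'a \<Rightarrow> real"
  assumes subalgebra_F: "t \<le> T \<Longrightarrow> subalgebra M (F t)"
    and F_mono: "s \<le> t \<Longrightarrow> t \<le> T \<Longrightarrow> subalgebra (F t) (F s)"
    and fixed_costs: "b0 \<le> 0" "0 \<le> a0"
    and Sb_measurable: "t \<le> T \<Longrightarrow> 0 \<le> v \<Longrightarrow> (\<lambda>\<omega>. Sb t \<omega> v) \<in> borel_measurable (F t)"
    and Sa_measurable: "t \<le> T \<Longrightarrow> 0 \<le> v \<Longrightarrow> (\<lambda>\<omega>. Sa t \<omega> v) \<in> borel_measurable (F t)"
    and Sb_inf_measurable: "t \<le> T \<Longrightarrow> Sb_inf t \<in> borel_measurable (F t)"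
    and Sa_inf_measurable: "t \<le> T \<Longrightarrow> Sa_inf t \<in> borel_measurable (F t)"
    and a1: "t \<le> T \<Longrightarrow> AE \<omega> in M.
        mono_on {0..} (Sb t \<omega>) \<and> continuous_on {0..} (Sb t \<omega>) \<and>
        (Sb t \<omega> \<longlongrightarrow> Sb_inf t \<omega>) at_top \<and>
        (\<forall>\<^sub>F v in at_top. Sb t \<omega> field_differentiable at v) \<and>
        ((\<lambda>v. v * deriv (Sb t \<omega>) v) \<longlongrightarrow> 0) at_top"
    and a2: "t \<le> T \<Longrightarrow> AE \<omega> in M.
        mono_on {0..} (\<lambda>v. b0 + v * Sb t \<omega> v) \<and> convex_on {0..} (\<lambda>v. b0 + v * Sb t \<omega> v)"
    and a3: "t \<le> T \<Longrightarrow> AE \<omega> in M.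
        antimono_on {0..} (Sa t \<omega>) \<and> continuous_on {0..} (Sa t \<omega>) \<and>
        (Sa t \<omega> \<longlongrightarrow> Sa_inf t \<omega>) at_top \<and>
        (\<forall>\<^sub>F v in at_top. Sa t \<omega> field_differentiable at v) \<and>
        ((\<lambda>v. v * deriv (Sa t \<omega>) v) \<longlongrightarrow> 0) at_top"
    and a4: "t \<le> T \<Longrightarrow> AE \<omega> in M.
        mono_on {0..} (\<lambda>v. a0 + v * Sa t \<omega> v) \<and> concave_on {0..} (\<lambda>v. a0 + v * Sa t \<omega> v)"
    and a5: "t \<le> T \<Longrightarrow> AE \<omega> in M. Sb_inf t \<omega> < Sa_inf t \<omega>"
begin

definition b :: "nat \<Rightarrow> 'a \<Rightarrow> real \<Rightarrow> real" where
  "b t \<omega> v = b0 + v * Sb t \<omega> v"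

definition a :: "nat \<Rightarrow> 'a \<Rightarrow> real \<Rightarrow> real" where
  "a t \<omega> v = a0 + v * Sa t \<omega> v"

definition L :: "nat \<Rightarrow> 'a \<Rightarrow> real \<times> real \<Rightarrow> real" where
  "L t \<omega> = (\<lambda>(x, y). if y \<ge> 0 then x + max 0 (b t \<omega> y) else x - a t \<omega> (- y))"

definition G :: "nat \<Rightarrow> 'a \<Rightarrow> (real \<times> real) set" where
  "G t \<omega> = {z. L t \<omega> z \<ge> 0}"

definition L_bar :: "nat \<Rightarrow> 'a \<Rightarrow> real \<times> real \<Rightarrow> real" where
  "L_bar t \<omega> = (\<lambda>(x, y). if y \<ge> 0 then x + y * Sb_inf t \<omega> else x + y * Sa_inf t \<omega>)"

definition K_bar :: "nat \<Rightarrow> 'a \<Rightarrow> (real \<times> real) set" where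
  "K_bar t \<omega> = {z. L_bar t \<omega> z \<ge> 0}"

definition \<delta> :: "nat \<Rightarrow> 'a \<Rightarrow> real \<times> real \<Rightarrow> real" where
  "\<delta> t \<omega> z = L_bar t \<omega> z - L t \<omega> z"

definition cond_gL0 :: bool where
  "cond_gL0 \<longleftrightarrow> (\<forall>t\<le>T.
     ((\<lambda>r. SUP y. Linf_norm M (\<lambda>\<omega>. \<delta> t \<omega> (r *\<^sub>R (0, y)) / r)) \<longlongrightarrow> 0) at_top)"

definition cond_L0 :: bool where
  "cond_L0 \<longleftrightarrow> (\<forall>c>0. \<forall>t\<le>T.
     ((\<lambda>r. SUP y\<in>{y. \<bar>y\<bar> \<le> c}. Linf_norm M (\<lambda>\<omega>. \<delta> t \<omega> (r *\<^sub>R (0, y)) / r)) \<longlongrightarrow> 0) at_top)"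

definition NSA :: bool where
  "NSA \<longleftrightarrow> \<not> strong_arbitrage M F T G (L T)"

definition NSA_bar :: bool where
  "NSA_bar \<longleftrightarrow> \<not> strong_arbitrage M F T K_bar (L_bar T)"

definition NrbSA :: bool where
  "NrbSA \<longleftrightarrow> \<not> rb_strong_arbitrage M F T G (L T)"

definition NrbSA_bar :: bool where
  "NrbSA_bar \<longleftrightarrow> \<not> rb_strong_arbitrage M F T K_bar (L_bar T)"

end

end

theory Submission
  imports Defs
begin

text \<open>
  Fixed costs and volume effects only make trading dearer than in the frictionless-volume limit:
  almost surely \<open>L \<le> L_bar\<close>, hence \<open>G \<subseteq> K_bar\<close>, and every arbitrage of the original market is
  one of the conic limit market.

  Conversely, the gap \<open>\<delta> = L_bar - L\<close> is assumed to grow sublinearly in the trade size, while the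
  profit in the conic market scales linearly. Let \<open>\<xi>\<close> be a strong arbitrage for the cones with profit \<open>m\<close>
  on \<open>B\<close>. Shrinking \<open>B\<close> to a set of positive probability makes the profit at least a constant
  \<open>c > 0\<close> (and, in the bounded case, all trades bounded by a constant). Multiply the strategy by
  a large number \<open>r\<close> and give up an extra cash amount \<open>r * \<epsilon>\<close> in each trade. Since \<open>L\<close> is
  translation invariant in cash and \<open>\<delta>\<close> at the scaled positions is at most \<open>r * \<epsilon>\<close>, each trade is
  now solvent in the original market, and the terminal liquidation value is still at least
  \<open>r * (c - (T + 2) * \<epsilon>)\<close>, which is positive for small \<open>\<epsilon>\<close>.

  The conditions on \<open>\<delta>\<close> speak about deterministic volumes \<open>y\<close>, with an exceptional null set
  that depends on \<open>y\<close>, whereas the strategy holds a random volume. Right-continuity of \<open>\<delta>\<close> in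
  \<open>y\<close> reduces the bound to rational \<open>y\<close> and so gives a common null set.
\<close>

section \<open>Uniform bounds off one null set\<close>

text \<open>A set of positive probability is exhausted by the sets on which a positive variable is
  bounded below by \<open>1 / (n + 1)\<close> and a finite variable is bounded above by \<open>n\<close>, so one of these
  already has positive probability.\<close>

lemma (in finite_measure) obtain_positive_measure_subset_bounded:
  fixes m \<alpha> :: "'a \<Rightarrow> real"
  assumes sub: "subalgebra M N" and B: "B \<in> sets N" "measure M B > 0"
    and m: "m \<in> borel_measurable N" and \<alpha>: "\<alpha> \<in> borel_measurable N"
    and pos: "AE \<omega> in M. \<omega> \<in> B \<longrightarrow> m \<omega> > 0"
  obtains B' c k where "B' \<in> sets N" "B' \<subseteq> B" "measure M B' > 0" "c > 0"
    "\<And>\<omega>. \<omega> \<in> B' \<Longrightarrow> m \<omega> \<ge> c \<and> \<alpha> \<omega> \<le> k"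
proof -
  define S where "S n = {\<omega> \<in> space N. \<omega> \<in> B \<and> m \<omega> \<ge> 1 / real (Suc n) \<and> \<alpha> \<omega> \<le> real n}" for n
  have S: "S n \<in> sets N" for n
    unfolding S_def using B m \<alpha> by measurable
  have SM: "S n \<in> sets M" for n
    using S sub by (auto simp: subalgebra_def)
  have BM: "B \<in> sets M"
    using B sub by (auto simp: subalgebra_def)
  have "\<exists>n. measure M (S n) > 0"
  proof (rule ccontr)
    assume "\<not> ?thesis"
    then have "measure M (S n) = 0" for n
      by (metis measure_nonneg less_eq_real_def)
    then have "S n \<in> null_sets M" for n
      using SM by (simp add: null_sets_def emeasure_eq_measure)
    then have "AE \<omega> in M. \<omega> \<notin> S n" for n
      by (rule AE_not_in)
    then have "AE \<omega> in M. \<forall>n. \<omega> \<notin> S n"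
      by (simp add: AE_all_countable)
    with pos have "AE \<omega> in M. \<omega> \<notin> B"
    proof eventually_elim
      case (elim \<omega>)
      show ?case
      proof
        assume \<omega>: "\<omega> \<in> B"
        then have "m \<omega> > 0"
          using elim by blast
        then obtain n1 where n1: "inverse (real (Suc n1)) < m \<omega>"
          using reals_Archimedean by blast
        obtain n2 :: nat where n2: "\<alpha> \<omega> \<le> real n2"
          using real_arch_simple by blast
        have "1 / real (Suc (max n1 n2)) \<le> 1 / real (Suc n1)"
          by (intro divide_left_mono) auto
        then have "1 / real (Suc (max n1 n2)) \<le> m \<omega>"
          using n1 by (simp add: inverse_eq_divide)
        moreover have "\<alpha> \<omega> \<le> real (max n1 n2)"
          using n2 by (simp add: max_def)
        moreover have "\<omega> \<in> space N"
          using \<omega> B(1) sets.sets_into_space by blast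
        ultimately have "\<omega> \<in> S (max n1 n2)"
          using \<omega> by (simp add: S_def)
        with elim show False
          by blast
      qed
    qed
    then have "measure M B = 0"
      using BM by (simp add: AE_iff_null_sets measure_eq_0_null_sets)
    with B show False
      by simp
  qed
  then obtain n where "measure M (S n) > 0"
    by blast
  then show thesis
    by (intro that[of "S n" "1 / real (Suc n)" "real n"] S) (auto simp: S_def)
qed

lemma Linf_norm_less_imp_AE_le:
  assumes "Linf_norm M f < ereal e"
  shows "AE \<omega> in M. \<bar>f \<omega>\<bar> \<le> e"
proof -
  have "AE \<omega> in M. ereal \<bar>f \<omega>\<bar> \<le> Linf_norm M f"
    unfolding Linf_norm_def by (rule esssup_AE)
  then show ?thesis
  proof eventually_elim
    case (elim \<omega>)
    then have "ereal \<bar>f \<omega>\<bar> < ereal e"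
      using assms by (rule le_less_trans)
    then show ?case
      by simp
  qed
qed

text \<open>Openness of \<open>Y\<close> leaves room for rationals to the right of each of its points.\<close>

lemma right_continuous_le_if_le_on_Rats:
  fixes h :: "real \<Rightarrow> real"
  assumes cont: "\<And>y. continuous (at_right y) h" and "open Y"
    and le: "\<And>q. q \<in> \<rat> \<Longrightarrow> q \<in> Y \<Longrightarrow> h q \<le> e" and y: "y \<in> Y"
  shows "h y \<le> e"
proof (rule ccontr)
  assume "\<not> h y \<le> e"
  moreover have "(h \<longlongrightarrow> h y) (at_right y)"
    using cont by (simp add: continuous_within)
  ultimately have "\<forall>\<^sub>F z in at_right y. h z > e"
    by (auto intro: order_tendstoD(1))
  moreover have "\<forall>\<^sub>F z in at_right y. z \<in> Y"
    using \<open>open Y\<close> y by (auto simp: eventually_at_topological)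
  ultimately have "\<forall>\<^sub>F z in at_right y. h z > e \<and> z \<in> Y"
    by (rule eventually_conj)
  then obtain z where z: "z > y" "\<And>w. y < w \<Longrightarrow> w < z \<Longrightarrow> h w > e \<and> w \<in> Y"
    by (auto simp: eventually_at_right_field)
  from Rats_dense_in_real[OF z(1)] obtain q where "q \<in> \<rat>" "y < q" "q < z"
    by blast
  with z(2) le show False
    by force
qed

context concave_cost_market
begin

section \<open>Liquidation values of the original and of the limit market\<close>

lemma L_add_cash: "L t \<omega> (z + (c, 0)) = L t \<omega> z + c"
  by (cases z) (simp add: L_def)

lemma L_bar_scaleR: "r > 0 \<Longrightarrow> L_bar t \<omega> (r *\<^sub>R z) = r * L_bar t \<omega> z"
  by (cases z) (auto simp: L_bar_def algebra_simps zero_le_mult_iff)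

lemma \<delta>_eq_\<delta>_volume: "\<delta> t \<omega> z = \<delta> t \<omega> (0, snd z)"
  by (cases z) (simp add: \<delta>_def L_def L_bar_def)

lemma zero_in_G: "0 \<in> G t \<omega>"
  using fixed_costs by (simp add: G_def L_def b_def zero_prod_def)

text \<open>Bid prices increase to \<open>Sb_inf\<close> and ask prices decrease to \<open>Sa_inf\<close>, and fixed costs have
  the unfavourable sign. Monotonicity of the revenue \<open>b\<close> gives \<open>0 \<le> Sb_inf\<close>, which covers the
  case in which the position is thrown away rather than sold.\<close>

lemma AE_L_le_L_bar:
  assumes t: "t \<le> T"
  shows "AE \<omega> in M. \<forall>z. L t \<omega> z \<le> L_bar t \<omega> z"
  using a1[OF t] a2[OF t] a3[OF t]
proof eventually_elim
  case (elim \<omega>)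
  have Sb_le: "Sb t \<omega> v \<le> Sb_inf t \<omega>" if "v \<ge> 0" for v
  proof (rule tendsto_lowerbound[of "Sb t \<omega>" _ at_top])
    show "\<forall>\<^sub>F w in at_top. Sb t \<omega> v \<le> Sb t \<omega> w"
      using eventually_ge_at_top[of v]
      by eventually_elim (use elim that in \<open>auto intro: mono_onD\<close>)
  qed (use elim in auto)
  have Sa_ge: "Sa_inf t \<omega> \<le> Sa t \<omega> v" if "v \<ge> 0" for v
  proof (rule tendsto_upperbound[of "Sa t \<omega>" _ at_top])
    show "\<forall>\<^sub>F w in at_top. Sa t \<omega> w \<le> Sa t \<omega> v"
      using eventually_ge_at_top[of v]
      by eventually_elim (use elim that in \<open>auto simp: monotone_on_def\<close>)
  qed (use elim in auto)
  have "b0 + 0 * Sb t \<omega> 0 \<le> b0 + 1 * Sb t \<omega> 1"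
    using elim by (auto dest: mono_onD[of _ _ 0 1])
  then have Sb_inf_nonneg: "0 \<le> Sb_inf t \<omega>"
    using Sb_le[of 1] by simp
  show ?case
  proof
    fix z :: "real \<times> real"
    obtain x y where z: "z = (x, y)"
      by (cases z)
    show "L t \<omega> z \<le> L_bar t \<omega> z"
    proof (cases "y \<ge> 0")
      case True
      then have "y * Sb t \<omega> y \<le> y * Sb_inf t \<omega>"
        by (intro mult_left_mono Sb_le)
      with True show ?thesis
        using fixed_costs Sb_inf_nonneg by (simp add: z L_def L_bar_def b_def)
    next
      case False
      then have "y * Sa t \<omega> (- y) \<le> y * Sa_inf t \<omega>"
        by (intro mult_left_mono_neg Sa_ge) auto
      moreover have "L t \<omega> z = x - a0 + y * Sa t \<omega> (- y)" "L_bar t \<omega> z = x + y * Sa_inf t \<omega>"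
        using False by (simp_all add: z L_def L_bar_def a_def)
      ultimately show ?thesis
        using fixed_costs by linarith
    qed
  qed
qed

text \<open>At \<open>0\<close> only right-continuity can be expected, since a positive fixed cost \<open>a0\<close> makes \<open>\<delta>\<close> jump
  there from the left.\<close>

lemma AE_right_continuous_\<delta>:
  assumes t: "t \<le> T"
  shows "AE \<omega> in M. \<forall>y. continuous (at_right y) (\<lambda>y. \<delta> t \<omega> (0, y))"
  using a1[OF t] a3[OF t]
proof eventually_elim
  case (elim \<omega>)
  let ?h = "\<lambda>y. \<delta> t \<omega> (0, y)"
  have "continuous_on {0..} (\<lambda>y. y * Sb_inf t \<omega> - max 0 (b0 + y * Sb t \<omega> y))"
    using elim by (intro continuous_intros) auto
  then have right: "continuous_on {0..} ?h"
    by (rule continuous_on_eq) (simp add: \<delta>_def L_def L_bar_def b_def)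
  have "continuous_on {..<0} (\<lambda>y. Sa t \<omega> (- y))"
    by (rule continuous_on_compose2[of "{0..}" "Sa t \<omega>"]) (use elim in \<open>auto intro!: continuous_intros\<close>)
  then have "continuous_on {..<0} (\<lambda>y. y * Sa_inf t \<omega> + (a0 - y * Sa t \<omega> (- y)))"
    by (intro continuous_intros)
  then have left: "continuous_on {..<0} ?h"
    by (rule continuous_on_eq) (simp add: \<delta>_def L_def L_bar_def a_def)
  show ?case
  proof
    fix y :: real
    show "continuous (at_right y) ?h"
    proof (cases "y \<ge> 0")
      case True
      then have "continuous (at y within {0..}) ?h"
        using right by (auto simp: continuous_on_eq_continuous_within)
      then show ?thesis
        by (rule continuous_within_subset) (use True in auto)
    next
      case False
      then have "continuous (at y) ?h"
        using left by (simp add: continuous_on_eq_continuous_at)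
      then show ?thesis
        by (rule continuous_within_subset) auto
    qed
  qed
qed

text \<open>Scaling by \<open>r\<close> preserves right-continuity, so the bound at rational volumes suffices.\<close>

lemma AE_\<delta>_le_on_open:
  assumes t: "t \<le> T" and r: "r > 0" and Y: "open Y"
    and less: "(SUP y\<in>Y. Linf_norm M (\<lambda>\<omega>. \<delta> t \<omega> (r *\<^sub>R (0, y)) / r)) < ereal e"
  shows "AE \<omega> in M. \<forall>z. snd z \<in> Y \<longrightarrow> \<delta> t \<omega> (r *\<^sub>R z) \<le> r * e"
proof -
  have "AE \<omega> in M. \<bar>\<delta> t \<omega> (r *\<^sub>R (0, q)) / r\<bar> \<le> e" if "q \<in> Y" for q
  proof (rule Linf_norm_less_imp_AE_le)
    show "Linf_norm M (\<lambda>\<omega>. \<delta> t \<omega> (r *\<^sub>R (0, q)) / r) < ereal e"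
      by (rule le_less_trans[OF SUP_upper less]) (rule that)
  qed
  then have "AE \<omega> in M. \<forall>q\<in>\<rat> \<inter> Y. \<bar>\<delta> t \<omega> (r *\<^sub>R (0, q)) / r\<bar> \<le> e"
    by (subst AE_ball_countable) (auto intro: countable_Int1 countable_rat)
  with AE_right_continuous_\<delta>[OF t] show ?thesis
  proof eventually_elim
    case (elim \<omega>)
    let ?h = "\<lambda>y. \<delta> t \<omega> (0, r * y)"
    have cont: "continuous (at_right y) ?h" for y
    proof -
      have "filterlim (\<lambda>y. r * y) (at_right (r * y)) (at_right y)"
        using r by (auto simp: filterlim_at eventually_at_right_less intro!: tendsto_eq_intros
            eventually_mono[OF eventually_at_right_less])
      moreover have "((\<lambda>y. \<delta> t \<omega> (0, y)) \<longlongrightarrow> \<delta> t \<omega> (0, r * y)) (at_right (r * y))"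
        using elim by (simp add: continuous_within)
      ultimately show ?thesis
        unfolding continuous_within by (rule filterlim_compose[rotated])
    qed
    have le: "?h q \<le> r * e" if "q \<in> \<rat>" "q \<in> Y" for q
    proof -
      have "\<delta> t \<omega> (r *\<^sub>R (0, q)) / r \<le> e"
        using elim(2) that by (auto intro: abs_le_D1)
      then show ?thesis
        using r by (simp add: field_simps)
    qed
    show ?case
    proof (intro allI impI)
      fix z :: "real \<times> real" assume "snd z \<in> Y"
      then have "?h (snd z) \<le> r * e"
        by (rule right_continuous_le_if_le_on_Rats[OF cont Y le, rotated -1])
      then show "\<delta> t \<omega> (r *\<^sub>R z) \<le> r * e"
        by (subst \<delta>_eq_\<delta>_volume) simp
    qed
  qed
qed

lemma cond_gL0_AE_\<delta>_le:
  assumes "cond_gL0" "e > 0"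
  obtains r where "r > 0" "\<And>t. t \<le> T \<Longrightarrow> AE \<omega> in M. \<forall>z. \<delta> t \<omega> (r *\<^sub>R z) \<le> r * e"
proof -
  have "\<forall>\<^sub>F r in at_top. \<forall>t\<in>{..T}. (SUP y. Linf_norm M (\<lambda>\<omega>. \<delta> t \<omega> (r *\<^sub>R (0, y)) / r)) < ereal e"
    using assms unfolding cond_gL0_def
    by (intro eventually_ball_finite ballI) (auto intro!: order_tendstoD(2))
  then have "\<forall>\<^sub>F r in at_top. r > 0 \<and>
      (\<forall>t\<in>{..T}. (SUP y. Linf_norm M (\<lambda>\<omega>. \<delta> t \<omega> (r *\<^sub>R (0, y)) / r)) < ereal e)"
    by (intro eventually_conj eventually_gt_at_top)
  then obtain r where "r > 0"
    "\<And>t. t \<le> T \<Longrightarrow> (SUP y. Linf_norm M (\<lambda>\<omega>. \<delta> t \<omega> (r *\<^sub>R (0, y)) / r)) < ereal e"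
    by (auto simp: eventually_at_top_linorder)
  then show thesis
    using AE_\<delta>_le_on_open[of _ r UNIV e] by (intro that[of r]) auto
qed

lemma cond_L0_AE_\<delta>_le:
  assumes "cond_L0" "e > 0" "c > 0"
  obtains r where "r > 0"
    "\<And>t. t \<le> T \<Longrightarrow> AE \<omega> in M. \<forall>z. \<bar>snd z\<bar> < c \<longrightarrow> \<delta> t \<omega> (r *\<^sub>R z) \<le> r * e"
proof -
  let ?s = "\<lambda>t Y r. SUP y\<in>Y. Linf_norm M (\<lambda>\<omega>. \<delta> t \<omega> (r *\<^sub>R (0, y)) / r)"
  have "\<forall>\<^sub>F r in at_top. \<forall>t\<in>{..T}. ?s t {y. \<bar>y\<bar> \<le> c} r < ereal e"
    using assms unfolding cond_L0_def
    by (intro eventually_ball_finite ballI) (auto intro!: order_tendstoD(2))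
  then have "\<forall>\<^sub>F r in at_top. r > 0 \<and> (\<forall>t\<in>{..T}. ?s t {y. \<bar>y\<bar> \<le> c} r < ereal e)"
    by (intro eventually_conj eventually_gt_at_top)
  then obtain r where r: "r > 0" "\<And>t. t \<le> T \<Longrightarrow> ?s t {y. \<bar>y\<bar> \<le> c} r < ereal e"
    by (auto simp: eventually_at_top_linorder)
  have "?s t {y. \<bar>y\<bar> < c} r < ereal e" if "t \<le> T" for t
    by (rule le_less_trans[OF SUP_subset_mono r(2)[OF that]]) auto
  then have "AE \<omega> in M. \<forall>z. snd z \<in> {y. \<bar>y\<bar> < c} \<longrightarrow> \<delta> t \<omega> (r *\<^sub>R z) \<le> r * e" if "t \<le> T" for t
    using that r(1) by (intro AE_\<delta>_le_on_open open_Collect_less continuous_intros) auto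
  then show thesis
    using r(1) by (intro that[of r]) simp_all
qed

section \<open>Transfer of strategies\<close>

lemma arbitrage_strategy_imp_bar:
  assumes "arbitrage_strategy M F T G (L T) t B \<xi> m"
  shows "arbitrage_strategy M F T K_bar (L_bar T) t B \<xi> m"
proof -
  have "\<xi> i \<in> L0 M (F i) (\<lambda>\<omega>. uminus ` K_bar i \<omega>)" if i: "i \<le> T" for i
  proof -
    have "\<xi> i \<in> L0 M (F i) (\<lambda>\<omega>. uminus ` G i \<omega>)"
      using assms i by (simp add: arbitrage_strategy_def)
    then have meas: "\<xi> i \<in> borel_measurable (F i)" and "AE \<omega> in M. \<xi> i \<omega> \<in> uminus ` G i \<omega>"
      by (auto simp: L0_def)
    from this(2) AE_L_le_L_bar[OF i] have "AE \<omega> in M. \<xi> i \<omega> \<in> uminus ` K_bar i \<omega>"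
    proof eventually_elim
      case (elim \<omega>)
      then have "G i \<omega> \<subseteq> K_bar i \<omega>"
        unfolding G_def K_bar_def by (blast intro: order_trans)
      with elim show ?case
        by blast
    qed
    with meas show ?thesis
      by (simp add: L0_def)
  qed
  moreover have "AE \<omega> in M. \<omega> \<in> B \<longrightarrow> L_bar T \<omega> (\<Sum>i=0..T. \<xi> i \<omega>) \<ge> m \<omega> \<and> m \<omega> > 0"
  proof -
    have "AE \<omega> in M. \<omega> \<in> B \<longrightarrow> L T \<omega> (\<Sum>i=0..T. \<xi> i \<omega>) \<ge> m \<omega> \<and> m \<omega> > 0"
      using assms by (simp add: arbitrage_strategy_def)
    with AE_L_le_L_bar[OF order_refl] show ?thesis
      by eventually_elim (blast intro: order_trans)
  qed
  ultimately show ?thesis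
    using assms by (simp add: arbitrage_strategy_def)
qed

definition scaled_strategy ::
  "real \<Rightarrow> real \<Rightarrow> nat \<Rightarrow> 'a set \<Rightarrow> (nat \<Rightarrow> 'a \<Rightarrow> real \<times> real) \<Rightarrow> nat \<Rightarrow> 'a \<Rightarrow> real \<times> real" where
  "scaled_strategy r e t B \<xi> i \<omega> = (if t \<le> i \<and> \<omega> \<in> B then r *\<^sub>R \<xi> i \<omega> - (r * e, 0) else 0)"

text \<open>The cash \<open>r * e\<close> given up in each of the at most \<open>T + 1\<close> trades pays for the gap at that
  trade; one further \<open>r * e\<close> is lost to the gap in the terminal liquidation.\<close>

lemma arbitrage_strategy_scaled:
  assumes strat: "arbitrage_strategy M F T K_bar (L_bar T) t B \<xi> m"
    and B': "B' \<in> sets (F t)" "B' \<subseteq> B" "measure M B' > 0"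
    and m_ge: "\<And>\<omega>. \<omega> \<in> B' \<Longrightarrow> m \<omega> \<ge> c"
    and r: "r > 0" and e: "e > 0" "real (T + 2) * e < c"
    and trades: "\<And>i. t \<le> i \<Longrightarrow> i \<le> T \<Longrightarrow> AE \<omega> in M. \<omega> \<in> B' \<longrightarrow> \<delta> i \<omega> (r *\<^sub>R (- \<xi> i \<omega>)) \<le> r * e"
    and final: "AE \<omega> in M. \<omega> \<in> B' \<longrightarrow> \<delta> T \<omega> (r *\<^sub>R (\<Sum>i=0..T. \<xi> i \<omega>)) \<le> r * e"
  shows "arbitrage_strategy M F T G (L T) t B' (scaled_strategy r e t B' \<xi>)
           (\<lambda>_. r * (c - real (T + 2) * e))"
proof -
  let ?\<xi> = "scaled_strategy r e t B' \<xi>"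
  have t: "t \<le> T"
    using strat by (simp add: arbitrage_strategy_def)
  have "?\<xi> i \<in> L0 M (F i) (\<lambda>\<omega>. uminus ` G i \<omega>)" if i: "i \<le> T" for i
  proof (cases "t \<le> i")
    case True
    have "\<xi> i \<in> L0 M (F i) (\<lambda>\<omega>. uminus ` K_bar i \<omega>)"
      using strat i by (simp add: arbitrage_strategy_def)
    then have [measurable]: "\<xi> i \<in> borel_measurable (F i)"
      and K: "AE \<omega> in M. \<xi> i \<omega> \<in> uminus ` K_bar i \<omega>"
      by (auto simp: L0_def)
    have [measurable]: "B' \<in> sets (F i)"
      using F_mono[OF True i] B'(1) by (auto simp: subalgebra_def)
    have "(\<lambda>\<omega>. if \<omega> \<in> B' then r *\<^sub>R \<xi> i \<omega> - (r * e, 0) else 0) \<in> borel_measurable (F i)"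
      by measurable
    then have "?\<xi> i \<in> borel_measurable (F i)"
      using True by (simp add: scaled_strategy_def[abs_def])
    moreover from K trades[OF True i] have "AE \<omega> in M. ?\<xi> i \<omega> \<in> uminus ` G i \<omega>"
    proof eventually_elim
      case (elim \<omega>)
      show ?case
      proof (cases "\<omega> \<in> B'")
        case \<omega>: True
        have "L_bar i \<omega> (- \<xi> i \<omega>) \<ge> 0"
          using elim by (auto simp: K_bar_def)
        then have "L_bar i \<omega> (r *\<^sub>R (- \<xi> i \<omega>)) \<ge> 0"
          using r by (subst L_bar_scaleR) auto
        then have "L i \<omega> (r *\<^sub>R (- \<xi> i \<omega>) + (r * e, 0)) \<ge> 0"
          using elim \<omega> by (simp only: L_add_cash) (simp add: \<delta>_def)
        moreover have "- ?\<xi> i \<omega> = r *\<^sub>R (- \<xi> i \<omega>) + (r * e, 0)"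
          using True \<omega> by (simp add: scaled_strategy_def)
        ultimately have "- ?\<xi> i \<omega> \<in> G i \<omega>"
          by (simp add: G_def)
        then show ?thesis
          by (metis imageI minus_minus)
      next
        case False
        then show ?thesis
          using zero_in_G[of i \<omega>] by (force simp: scaled_strategy_def)
      qed
    qed
    ultimately show ?thesis
      by (simp add: L0_def)
  next
    case False
    then show ?thesis
      using zero_in_G[of i] by (force simp: scaled_strategy_def[abs_def] L0_def)
  qed
  moreover have "AE \<omega> in M. \<omega> \<in> B' \<longrightarrow> L T \<omega> (\<Sum>i=0..T. ?\<xi> i \<omega>) \<ge> r * (c - real (T + 2) * e)"
  proof -
    have "\<forall>i\<in>{..<t}. AE \<omega> in M. \<xi> i \<omega> = 0"
      using strat by (simp add: arbitrage_strategy_def)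
    then have before: "AE \<omega> in M. \<forall>i\<in>{..<t}. \<xi> i \<omega> = 0"
      by (simp add: AE_ball_countable)
    have "AE \<omega> in M. \<omega> \<in> B \<longrightarrow> L_bar T \<omega> (\<Sum>i=0..T. \<xi> i \<omega>) \<ge> m \<omega>"
      using strat by (auto simp: arbitrage_strategy_def elim: eventually_mono)
    with before final show ?thesis
    proof eventually_elim
      case (elim \<omega>)
      show ?case
      proof
        assume \<omega>: "\<omega> \<in> B'"
        let ?V = "\<Sum>i=0..T. \<xi> i \<omega>"
        let ?n = "real (card {t..T})"
        have "(\<Sum>i=0..T. ?\<xi> i \<omega>) = (\<Sum>i=0..T. r *\<^sub>R \<xi> i \<omega> - (if i \<in> {t..T} then (r * e, 0) else 0))"
          using elim \<omega> by (intro sum.cong) (auto simp: scaled_strategy_def)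
        also have "\<dots> = r *\<^sub>R ?V - (\<Sum>i\<in>{0..T} \<inter> {t..T}. (r * e, 0))"
          by (simp only: sum_subtractf scaleR_sum_right sum.inter_restrict[OF finite_atLeastAtMost])
        also have "{0..T} \<inter> {t..T} = {t..T}"
          by auto
        also have "(\<Sum>i\<in>{t..T}. (r * e, 0)) = (?n * (r * e), 0 :: real)"
          by (simp add: sum_constant_scaleR)
        also have "r *\<^sub>R ?V - (?n * (r * e), 0) = r *\<^sub>R ?V + (- (?n * (r * e)), 0)"
          by (simp add: prod_eq_iff)
        finally have "L T \<omega> (\<Sum>i=0..T. ?\<xi> i \<omega>) = L T \<omega> (r *\<^sub>R ?V) - ?n * (r * e)"
          by (simp only: L_add_cash)
        also have "L T \<omega> (r *\<^sub>R ?V) = r * L_bar T \<omega> ?V - \<delta> T \<omega> (r *\<^sub>R ?V)"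
          using r by (simp add: \<delta>_def L_bar_scaleR)
        also have "r * c - r * e - real (T + 1) * (r * e) \<le> r * L_bar T \<omega> ?V - \<delta> T \<omega> (r *\<^sub>R ?V) - ?n * (r * e)"
        proof (intro diff_mono)
          show "r * c \<le> r * L_bar T \<omega> ?V"
            using elim \<omega> B'(2) m_ge[OF \<omega>] r by (intro mult_left_mono) auto
          show "\<delta> T \<omega> (r *\<^sub>R ?V) \<le> r * e"
            using elim \<omega> by blast
          show "?n * (r * e) \<le> real (T + 1) * (r * e)"
            using r e by (intro mult_right_mono) auto
        qed
        finally show "L T \<omega> (\<Sum>i=0..T. ?\<xi> i \<omega>) \<ge> r * (c - real (T + 2) * e)"
          by (simp add: algebra_simps)
      qed
    qed
  qed
  ultimately show ?thesis
    using t B' r e by (auto simp: arbitrage_strategy_def L0_def scaled_strategy_def)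
qed

section \<open>Equivalence of the absence of arbitrage\<close>

lemma NSA_iff_NSA_bar:
  assumes "cond_gL0"
  shows "NSA \<longleftrightarrow> NSA_bar"
proof
  assume "NSA_bar"
  then show "NSA"
    unfolding NSA_def NSA_bar_def strong_arbitrage_def by (blast dest: arbitrage_strategy_imp_bar)
next
  assume "NSA"
  show "NSA_bar"
    unfolding NSA_bar_def
  proof
    assume "strong_arbitrage M F T K_bar (L_bar T)"
    then obtain t B \<xi> m where strat: "arbitrage_strategy M F T K_bar (L_bar T) t B \<xi> m"
      by (auto simp: strong_arbitrage_def)
    have "subalgebra M (F t)" "B \<in> sets (F t)" "measure M B > 0" "m \<in> borel_measurable (F t)"
      "(\<lambda>_. 0 :: real) \<in> borel_measurable (F t)" "AE \<omega> in M. \<omega> \<in> B \<longrightarrow> m \<omega> > 0"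
      using strat by (auto simp: arbitrage_strategy_def L0_def subalgebra_F elim: eventually_mono)
    then obtain B' c where B': "B' \<in> sets (F t)" "B' \<subseteq> B" "measure M B' > 0" and c: "c > 0"
      and m_ge: "\<And>\<omega>. \<omega> \<in> B' \<Longrightarrow> m \<omega> \<ge> c"
      by (rule obtain_positive_measure_subset_bounded) auto
    define e where "e = c / real (T + 3)"
    have e: "e > 0" "real (T + 2) * e < c"
      using c by (auto simp: e_def field_simps)
    obtain r where r: "r > 0" and gap: "\<And>i. i \<le> T \<Longrightarrow> AE \<omega> in M. \<forall>z. \<delta> i \<omega> (r *\<^sub>R z) \<le> r * e"
      using cond_gL0_AE_\<delta>_le[OF assms e(1)] by blast
    have "arbitrage_strategy M F T G (L T) t B' (scaled_strategy r e t B' \<xi>)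
        (\<lambda>_. r * (c - real (T + 2) * e))"
      by (rule arbitrage_strategy_scaled[OF strat B' m_ge r e])
        (use gap in \<open>blast intro: eventually_mono\<close>)+
    with \<open>NSA\<close> show False
      unfolding NSA_def strong_arbitrage_def by blast
  qed
qed

text \<open>A bound \<open>k\<close> on each single trade bounds the terminal position by \<open>(T + 1) * k\<close>, so only
  volumes in a fixed compact interval occur and the local condition on \<open>\<delta>\<close> is enough. The scaled
  strategy is again bounded, by \<open>r * k + r * e\<close>.\<close>

lemma NrbSA_iff_NrbSA_bar:
  assumes "cond_L0"
  shows "NrbSA \<longleftrightarrow> NrbSA_bar"
proof
  assume "NrbSA_bar"
  then show "NrbSA"
    unfolding NrbSA_def NrbSA_bar_def rb_strong_arbitrage_def
    by (blast dest: arbitrage_strategy_imp_bar)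
next
  assume "NrbSA"
  show "NrbSA_bar"
    unfolding NrbSA_bar_def
  proof
    assume "rb_strong_arbitrage M F T K_bar (L_bar T)"
    then obtain t B \<xi> m \<alpha> where strat: "arbitrage_strategy M F T K_bar (L_bar T) t B \<xi> m"
      and \<alpha>: "\<alpha> \<in> L0 M (F t) (\<lambda>_. {0<..})"
      and \<xi>_le: "\<forall>u\<in>{t..T}. AE \<omega> in M. \<omega> \<in> B \<longrightarrow> \<bar>fst (\<xi> u \<omega>)\<bar> + \<bar>snd (\<xi> u \<omega>)\<bar> \<le> \<alpha> \<omega>"
      unfolding rb_strong_arbitrage_def by blast
    have "subalgebra M (F t)" "B \<in> sets (F t)" "measure M B > 0" "m \<in> borel_measurable (F t)"
      "\<alpha> \<in> borel_measurable (F t)" "AE \<omega> in M. \<omega> \<in> B \<longrightarrow> m \<omega> > 0"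
      using strat \<alpha> by (auto simp: arbitrage_strategy_def L0_def subalgebra_F elim: eventually_mono)
    then obtain B' c k0 where B': "B' \<in> sets (F t)" "B' \<subseteq> B" "measure M B' > 0" and c: "c > 0"
      and bounds: "\<And>\<omega>. \<omega> \<in> B' \<Longrightarrow> m \<omega> \<ge> c \<and> \<alpha> \<omega> \<le> k0"
      by (rule obtain_positive_measure_subset_bounded) auto
    define k where "k = max 0 k0"
    have k: "k \<ge> 0"
      by (simp add: k_def)
    have \<xi>_le_k: "AE \<omega> in M. \<omega> \<in> B' \<longrightarrow> \<bar>fst (\<xi> u \<omega>)\<bar> + \<bar>snd (\<xi> u \<omega>)\<bar> \<le> k" if "u \<in> {t..T}" for u
      using \<xi>_le[rule_format, OF that]
    proof eventually_elim
      case (elim \<omega>)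
      then show ?case
        using B'(2) bounds[of \<omega>] unfolding k_def by fastforce
    qed
    have volume: "AE \<omega> in M. \<omega> \<in> B' \<longrightarrow> \<bar>snd (\<xi> i \<omega>)\<bar> \<le> k" if "i \<le> T" for i
    proof (cases "t \<le> i")
      case True
      with that have "i \<in> {t..T}"
        by simp
      from \<xi>_le_k[OF this] show ?thesis
        by eventually_elim (auto intro: order_trans[rotated])
    next
      case False
      then have "AE \<omega> in M. \<xi> i \<omega> = 0"
        using strat by (simp add: arbitrage_strategy_def)
      then show ?thesis
        by eventually_elim (simp add: k)
    qed
    (* The added 1 keeps the volumes strictly inside the open interval on which \<delta> is controlled. *)
    define d where "d = real (T + 1) * k + 1"
    have d: "d > 0" "k < d"
      using k by (auto simp: d_def algebra_simps intro: add_nonneg_pos add_pos_nonneg)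
    define e where "e = c / real (T + 3)"
    have e: "e > 0" "real (T + 2) * e < c"
      using c by (auto simp: e_def field_simps)
    obtain r where r: "r > 0"
      and gap: "\<And>i. i \<le> T \<Longrightarrow> AE \<omega> in M. \<forall>z. \<bar>snd z\<bar> < d \<longrightarrow> \<delta> i \<omega> (r *\<^sub>R z) \<le> r * e"
      using cond_L0_AE_\<delta>_le[OF assms e(1) d(1)] by blast
    have "arbitrage_strategy M F T G (L T) t B' (scaled_strategy r e t B' \<xi>)
        (\<lambda>_. r * (c - real (T + 2) * e))"
    proof (rule arbitrage_strategy_scaled[OF strat B' _ r e])
      show "m \<omega> \<ge> c" if "\<omega> \<in> B'" for \<omega>
        using bounds that by blast
    next
      fix i assume "t \<le> i" and i: "i \<le> T"
      from volume[OF i] gap[OF i]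
      show "AE \<omega> in M. \<omega> \<in> B' \<longrightarrow> \<delta> i \<omega> (r *\<^sub>R (- \<xi> i \<omega>)) \<le> r * e"
      proof eventually_elim
        case (elim \<omega>)
        show ?case
        proof
          assume "\<omega> \<in> B'"
          then have "\<bar>snd (- \<xi> i \<omega>)\<bar> < d"
            using elim(1) d by simp
          with elim(2) show "\<delta> i \<omega> (r *\<^sub>R (- \<xi> i \<omega>)) \<le> r * e"
            by blast
        qed
      qed
    next
      have "AE \<omega> in M. \<forall>i\<in>{0..T}. \<omega> \<in> B' \<longrightarrow> \<bar>snd (\<xi> i \<omega>)\<bar> \<le> k"
        using volume by (intro AE_finite_allI) auto
      with gap[OF order_refl]
      show "AE \<omega> in M. \<omega> \<in> B' \<longrightarrow> \<delta> T \<omega> (r *\<^sub>R (\<Sum>i=0..T. \<xi> i \<omega>)) \<le> r * e"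
      proof eventually_elim
        case (elim \<omega>)
        show ?case
        proof
          assume \<omega>: "\<omega> \<in> B'"
          have "\<bar>snd (\<Sum>i=0..T. \<xi> i \<omega>)\<bar> \<le> (\<Sum>i=0..T. \<bar>snd (\<xi> i \<omega>)\<bar>)"
            by (simp add: snd_sum)
          also have "\<dots> \<le> of_nat (card {0..T}) * k"
            using elim \<omega> by (intro sum_bounded_above) auto
          also have "\<dots> < d"
            by (simp add: d_def)
          finally show "\<delta> T \<omega> (r *\<^sub>R (\<Sum>i=0..T. \<xi> i \<omega>)) \<le> r * e"
            using elim by blast
        qed
      qed
    qed
    moreover have "(\<lambda>_. r * k + r * e) \<in> L0 M (F t) (\<lambda>_. {0<..})"
      using r k e by (auto simp: L0_def intro: add_nonneg_pos)
    moreover have "\<forall>u\<in>{t..T}. AE \<omega> in M. \<omega> \<in> B' \<longrightarrow>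
        \<bar>fst (scaled_strategy r e t B' \<xi> u \<omega>)\<bar> + \<bar>snd (scaled_strategy r e t B' \<xi> u \<omega>)\<bar> \<le> r * k + r * e"
    proof
      fix u assume u: "u \<in> {t..T}"
      from \<xi>_le_k[OF u] show "AE \<omega> in M. \<omega> \<in> B' \<longrightarrow>
        \<bar>fst (scaled_strategy r e t B' \<xi> u \<omega>)\<bar> + \<bar>snd (scaled_strategy r e t B' \<xi> u \<omega>)\<bar> \<le> r * k + r * e"
      proof eventually_elim
        case (elim \<omega>)
        show ?case
        proof
          assume \<omega>: "\<omega> \<in> B'"
          let ?x = "fst (\<xi> u \<omega>)" and ?y = "snd (\<xi> u \<omega>)"
          have "\<bar>r * ?x - r * e\<bar> + \<bar>r * ?y\<bar> \<le> r * (\<bar>?x\<bar> + \<bar>?y\<bar>) + r * e"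
            using abs_triangle_ineq4[of "r * ?x" "r * e"] r e by (simp add: abs_mult algebra_simps)
          also have "\<dots> \<le> r * k + r * e"
            using elim \<omega> r by (intro add_right_mono mult_left_mono) auto
          finally show "\<bar>fst (scaled_strategy r e t B' \<xi> u \<omega>)\<bar> + \<bar>snd (scaled_strategy r e t B' \<xi> u \<omega>)\<bar>
              \<le> r * k + r * e"
            using u \<omega> by (simp add: scaled_strategy_def)
        qed
      qed
    qed
    ultimately have "rb_strong_arbitrage M F T G (L T)"
      unfolding rb_strong_arbitrage_def
      by (intro exI[of _ t] exI[of _ B'] exI[of _ "scaled_strategy r e t B' \<xi>"]
          exI[of _ "\<lambda>_. r * (c - real (T + 2) * e)"] conjI bexI[of _ "\<lambda>_. r * k + r * e"])
    with \<open>NrbSA\<close> show False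
      by (simp add: NrbSA_def)
  qed
qed

end

theorem theorem3p5:
  fixes M :: "'a measure"
    and F :: "nat \<Rightarrow> 'a measure"
    and T :: nat
    and b0 a0 :: real
    and Sb Sa :: "nat \<Rightarrow> 'a \<Rightarrow> real \<Rightarrow> real"
    and Sb_inf Sa_inf :: "nat \<Rightarrow> 'a \<Rightarrow> real"
  assumes "concave_cost_market M F T b0 a0 Sb Sa Sb_inf Sa_inf"
  shows "(concave_cost_market.cond_gL0 M T b0 a0 Sb Sa Sb_inf Sa_inf \<longrightarrow>
           (concave_cost_market.NSA M F T b0 a0 Sb Sa \<longleftrightarrow>
            concave_cost_market.NSA_bar M F T Sb_inf Sa_inf)) \<and>
         (Linf_norm M (\<lambda>\<omega>. Sa T \<omega> 0) < \<infinity> \<and>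
          concave_cost_market.cond_L0 M T b0 a0 Sb Sa Sb_inf Sa_inf \<longrightarrow>
           (concave_cost_market.NrbSA M F T b0 a0 Sb Sa \<longleftrightarrow>
            concave_cost_market.NrbSA_bar M F T Sb_inf Sa_inf))"
proof -
  interpret concave_cost_market M F T b0 a0 Sb Sa Sb_inf Sa_inf
    by (rule assms)
  show ?thesis
    using NSA_iff_NSA_bar NrbSA_iff_NrbSA_bar by blast
qed

end
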